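(* Let $N\ge1$, $1<p<\infty$, $m>p'$ and $\chi,M>0$. For every $s\in(0,N/p)$ let $\rho_s\in\mathcal Y_M$ minimize $\mathcal F_{s,p}$ over $\mathcal Y_M$, and let $$\mathcal D_s=\frac{p^*_s-m'}{M}\|\rho_s\|_m^m.$$ Then $$\limsup_{s\to0}\mathcal F_{s,p}(\rho_s)<0\qquad\text{and}\qquad\limsup_{s\to0}\mathcal D_s>0.$$
   Context: Riesz kernel. $K_{s/2}(x)=c_{N,s/2}|x|^{s-N}$, where $c_{N,s}=\pi^{-N/2}2^{-2s}\Gamma(N/2-s)/\Gamma(s)$. Exponents. $p'=p/(p-1)$, $m'=m/(m-1)$, and $p^*_s=Np/(N-sp)$. Admissible class. $\mathcal Y_M=\{\rho\in L^1_+\cap L^m(\mathbb R^N):\ \int\rho=M,\ \int x\rho=0\}$. Free energy. $\displaystyle\mathcal F_{s,p}(\rho)=\frac1{m-1}\int\rho^m-\frac{\chi}{p'}\int(K_{s/2}*\rho)^{p'}$. *)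

theory Defs
  imports "HOL-Analysis.Analysis"
begin

text \<open>Hoelder conjugate exponent q' = q/(q-1).\<close>
definition conj_exp :: "real \<Rightarrow> real" where
  "conj_exp q = q / (q - 1)"

text \<open>Fractional Sobolev exponent p^*_s = N p / (N - s p).\<close>
definition sobolev_exp :: "real \<Rightarrow> real \<Rightarrow> real \<Rightarrow> real" where
  "sobolev_exp N s p = N * p / (N - s * p)"

text \<open>c_{N,a} = pi^(-N/2) 2^(-2a) Gamma(N/2 - a) / Gamma(a).\<close>
definition riesz_const :: "real \<Rightarrow> real \<Rightarrow> real" where
  "riesz_const N a = pi powr (- N / 2) * 2 powr (- 2 * a) * Gamma (N / 2 - a) / Gamma a"

text \<open>K_a(x) = c_{N,a} |x|^(2a - N); the paper's K_{s/2} is riesz_kernel N (s/2).\<close>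
definition riesz_kernel :: "real \<Rightarrow> real \<Rightarrow> 'a::real_normed_vector \<Rightarrow> real" where
  "riesz_kernel N a x = riesz_const N a * norm x powr (2 * a - N)"

definition conv :: "('a::euclidean_space \<Rightarrow> real) \<Rightarrow> ('a \<Rightarrow> real) \<Rightarrow> 'a \<Rightarrow> real" where
  "conv K \<rho> x = (\<integral>y. K (x - y) * \<rho> y \<partial>lebesgue)"

text \<open>Admissible class Y_M (depends on m through L^m).\<close>
definition admissible :: "real \<Rightarrow> real \<Rightarrow> ('a::euclidean_space \<Rightarrow> real) set" where
  "admissible m M = {\<rho>. (\<forall>x. 0 \<le> \<rho> x) \<and> integrable lebesgue \<rho>
      \<and> integrable lebesgue (\<lambda>x. \<rho> x powr m)
      \<and> (\<integral>x. \<rho> x \<partial>lebesgue) = M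
      \<and> integrable lebesgue (\<lambda>x. \<rho> x *\<^sub>R x)
      \<and> (\<integral>x. \<rho> x *\<^sub>R x \<partial>lebesgue) = 0}"

text \<open>Free energy F_{s,p} with parameters m, chi.\<close>
definition free_energy :: "real \<Rightarrow> real \<Rightarrow> real \<Rightarrow> real \<Rightarrow> ('a::euclidean_space \<Rightarrow> real) \<Rightarrow> real" where
  "free_energy m chi s p \<rho> =
     1 / (m - 1) * (\<integral>x. \<rho> x powr m \<partial>lebesgue)
     - chi / conj_exp p *
       (\<integral>x. conv (riesz_kernel (real DIM('a)) (s / 2)) \<rho> x powr conj_exp p \<partial>lebesgue)"

end

theory Submission
  imports Defs "HOL-Real_Asymp.Real_Asymp"
begin

text \<open>
  Test the free energy with the uniform density of height \<open>h\<close> and mass \<open>M\<close> on a ball. Its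
  Riesz potential is bounded below on the half ball by \<open>c(N, s/2) h\<close> times the integral of
  \<open>|z| powr (s - N)\<close> over a ball. Splitting that integral into dyadic annuli shows that it is of
  order \<open>1 / (2 powr s - 1) \<sim> 1 / (s ln 2)\<close>, which compensates the factor \<open>1 / \<Gamma>(s/2) \<sim> s/2\<close>
  in \<open>c(N, s/2)\<close>. So the interaction energy of the test density stays bounded below as
  \<open>s \<rightarrow> 0\<close>, and since \<open>m > p'\<close> a small height makes its free energy, hence the minimal energy,
  at most a fixed \<open>-c < 0\<close>.

  Comparing a minimizer with its mass-preserving dilations \<open>\<lambda>^N \<rho>(\<lambda> x)\<close> gives the virial identity
  \<open>N \<integral>\<rho>^m = \<chi>/p' ((N - s) p' - N) \<integral>(K * \<rho>)^p'\<close>. Inserted into \<open>F(\<rho>\<^sub>s) \<le> -c\<close>, it bounds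
  \<open>\<integral>\<rho>\<^sub>s^m\<close> from below, while the prefactor satisfies \<open>p*\<^sub>s - m' \<ge> p - m' > 0\<close>.
\<close>

section \<open>Exponents\<close>

lemma conj_exp_gt_one: "1 < p \<Longrightarrow> 1 < conj_exp p"
  by (simp add: conj_exp_def)

lemma less_mult_conj_exp_iff:
  assumes "1 < p"
  shows "N < (N - s) * conj_exp p \<longleftrightarrow> s * p < N"
  using assms by (simp add: conj_exp_def field_simps)

lemma conj_exp_less_swap:
  assumes "1 < p" and "conj_exp p < m"
  shows "conj_exp m < p"
proof -
  have "1 < m"
    using assms conj_exp_gt_one[of p] by linarith
  then show ?thesis
    using assms by (simp add: conj_exp_def field_simps)
qed

lemma le_sobolev_exp:
  assumes "0 < p" and "0 \<le> s" and "s * p < N"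
  shows "p \<le> sobolev_exp N s p"
  using assms by (simp add: sobolev_exp_def field_simps mult_left_mono)

section \<open>Dilations of Lebesgue measure\<close>

lemma lebesgue_dilation:
  fixes c :: real
  assumes "c \<noteq> 0"
  shows "(lebesgue :: 'a::euclidean_space measure) =
    density (distr lebesgue lebesgue ((*\<^sub>R) c)) (\<lambda>_. ennreal (\<bar>c\<bar> ^ DIM('a)))"
proof -
  have "(\<lambda>x::'a. 0 + (\<Sum>j\<in>Basis. (c * (x \<bullet> j)) *\<^sub>R j)) = (*\<^sub>R) c"
    unfolding scaleR_scaleR[symmetric] scaleR_sum_right[symmetric] euclidean_representation
    by auto
  then show ?thesis
    using lebesgue_affine_euclidean[where 'a='a, of "\<lambda>_. c" 0] assms by (simp add: prod_constant)
qed

lemma borel_measurable_dilation_iff: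
  fixes f :: "'a::euclidean_space \<Rightarrow> 'b::topological_space"
  assumes "c \<noteq> 0"
  shows "(\<lambda>x. f (c *\<^sub>R x)) \<in> borel_measurable lebesgue \<longleftrightarrow> f \<in> borel_measurable lebesgue"
proof
  assume "(\<lambda>x. f (c *\<^sub>R x)) \<in> borel_measurable lebesgue"
  from measurable_comp[OF lebesgue_measurable_scaling[of "1 / c"] this]
  show "f \<in> borel_measurable lebesgue" using assms by (simp add: comp_def)
next
  assume "f \<in> borel_measurable lebesgue"
  from measurable_comp[OF lebesgue_measurable_scaling[of c] this]
  show "(\<lambda>x. f (c *\<^sub>R x)) \<in> borel_measurable lebesgue" by (simp add: comp_def)
qed

lemma integrable_dilation_iff:
  fixes f :: "'a::euclidean_space \<Rightarrow> 'b::{banach, second_countable_topology}"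
  assumes c: "c \<noteq> 0"
  shows "integrable lebesgue (\<lambda>x. f (c *\<^sub>R x)) \<longleftrightarrow> integrable lebesgue f"
proof (cases "f \<in> borel_measurable lebesgue")
  case True
  have "integrable lebesgue f \<longleftrightarrow>
      integrable (distr lebesgue lebesgue ((*\<^sub>R) c)) (\<lambda>x. (\<bar>c\<bar> ^ DIM('a)) *\<^sub>R f x)"
    using True by (subst lebesgue_dilation[OF c]) (simp add: integrable_density)
  also have "\<dots> \<longleftrightarrow> integrable (distr lebesgue lebesgue ((*\<^sub>R) c)) f"
  proof
    assume "integrable (distr lebesgue lebesgue ((*\<^sub>R) c)) (\<lambda>x. (\<bar>c\<bar> ^ DIM('a)) *\<^sub>R f x)"
    from integrable_scaleR_right[OF this, of "1 / \<bar>c\<bar> ^ DIM('a)"]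
    show "integrable (distr lebesgue lebesgue ((*\<^sub>R) c)) f" using c by simp
  qed (rule integrable_scaleR_right)
  also have "\<dots> \<longleftrightarrow> integrable lebesgue (\<lambda>x. f (c *\<^sub>R x))"
    by (rule integrable_distr_eq[OF lebesgue_measurable_scaling True])
  finally show ?thesis ..
next
  case False
  then show ?thesis
    using borel_measurable_dilation_iff[OF c, of f] by (auto dest: borel_measurable_integrable)
qed

lemma integral_dilation:
  fixes f :: "'a::euclidean_space \<Rightarrow> 'b::{banach, second_countable_topology}"
  assumes c: "c \<noteq> 0"
  shows "(\<integral>x. f (c *\<^sub>R x) \<partial>lebesgue) = (1 / \<bar>c\<bar> ^ DIM('a)) *\<^sub>R (\<integral>x. f x \<partial>lebesgue)"
proof (cases "f \<in> borel_measurable lebesgue")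
  case True
  have "(\<integral>x. f x \<partial>lebesgue) =
      (\<integral>x. (\<bar>c\<bar> ^ DIM('a)) *\<^sub>R f x \<partial>distr lebesgue lebesgue ((*\<^sub>R) c))"
    using True by (subst lebesgue_dilation[OF c]) (simp add: integral_density)
  also have "\<dots> = (\<bar>c\<bar> ^ DIM('a)) *\<^sub>R (\<integral>x. f (c *\<^sub>R x) \<partial>lebesgue)"
    by (simp add: integral_distr[OF lebesgue_measurable_scaling True])
  finally show ?thesis using c by simp
next
  case False
  then have "\<not> integrable lebesgue f" "\<not> integrable lebesgue (\<lambda>x. f (c *\<^sub>R x))"
    using borel_measurable_dilation_iff[OF c, of f] by (auto dest: borel_measurable_integrable)
  then show ?thesis by (simp add: not_integrable_integral_eq)
qed

lemma integral_dilation_pos: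
  fixes f :: "'a::euclidean_space \<Rightarrow> real"
  assumes "0 < c"
  shows "(\<integral>x. f (c *\<^sub>R x) \<partial>lebesgue) = c powr (- real DIM('a)) * (\<integral>x. f x \<partial>lebesgue)"
  using integral_dilation[of c f] assms by (simp add: powr_minus powr_realpow divide_inverse)

lemma lebesgue_integral_odd:
  fixes f :: "'a::euclidean_space \<Rightarrow> 'b::{banach, second_countable_topology}"
  assumes "\<And>x. f (- x) = - f x"
  shows "(\<integral>x. f x \<partial>lebesgue) = 0"
proof -
  have "(\<integral>x. f x \<partial>lebesgue) = (\<integral>x. f ((-1) *\<^sub>R x) \<partial>lebesgue)"
    using integral_dilation[of "-1" f] by simp
  also have "\<dots> = - (\<integral>x. f x \<partial>lebesgue)"
    by (simp add: assms)
  finally have "(2::real) *\<^sub>R (\<integral>x. f x \<partial>lebesgue) = 0"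
    by (simp add: scaleR_2 eq_neg_iff_add_eq_0)
  then show ?thesis
    by simp
qed

lemma nn_integral_lborel_reflection:
  fixes g :: "'a::euclidean_space \<Rightarrow> ennreal"
  assumes [measurable]: "g \<in> borel_measurable borel"
  shows "(\<integral>\<^sup>+y. g y \<partial>lborel) = (\<integral>\<^sup>+z. g (x - z) \<partial>lborel)"
  by (subst lborel_affine[of "-1" x]) (simp_all add: nn_integral_density nn_integral_distr)

section \<open>Integrals of powers of the norm over balls and their complements\<close>

definition annulus :: "real \<Rightarrow> 'a::real_normed_vector set" where
  "annulus t = {z. t \<le> norm z \<and> norm z < 2 * t}"

lemma annulus_borel: "annulus t \<in> sets borel"
  unfolding annulus_def by measurable

lemma annulus_eq_ball_diff: "annulus t = ball 0 (2 * t) - ball 0 t"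
  by (auto simp: annulus_def)

lemma mem_dyadic_annulus_iff:
  assumes "0 < r"
  shows "z \<in> annulus (r * 2 powr k) \<longleftrightarrow> z \<noteq> 0 \<and> \<lfloor>log 2 (norm z / r)\<rfloor> = k"
proof (cases "z = 0")
  case False
  have "z \<in> annulus (r * 2 powr k) \<longleftrightarrow> 2 powr k \<le> norm z / r \<and> norm z / r < 2 powr (k + 1)"
    using assms by (simp add: annulus_def powr_add field_simps)
  also have "\<dots> \<longleftrightarrow> \<lfloor>log 2 (norm z / r)\<rfloor> = k"
    using assms False by (simp add: floor_log_eq_powr_iff)
  finally show ?thesis using False by simp
qed (use assms in \<open>simp add: annulus_def mult_le_0_iff\<close>)

lemma disjoint_family_dyadic_annuli:
  fixes f :: "'i \<Rightarrow> int"
  assumes "0 < r" and "inj f"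
  shows "disjoint_family (\<lambda>k. annulus (r * 2 powr real_of_int (f k)) :: 'a::real_normed_vector set)"
  unfolding disjoint_family_on_def
proof (intro ballI impI)
  fix k l :: 'i
  assume "k \<noteq> l"
  then have "f k \<noteq> f l" using \<open>inj f\<close> by (meson injD)
  then show "annulus (r * 2 powr real_of_int (f k)) \<inter> annulus (r * 2 powr real_of_int (f l)) = ({} :: 'a set)"
    by (auto simp only: mem_dyadic_annulus_iff[OF \<open>0 < r\<close>] Int_iff empty_iff)
qed

lemma ball_minus_origin_eq_dyadic_annuli:
  assumes "0 < r"
  shows "ball 0 r - {0} = (\<Union>k::nat. annulus (r * 2 powr real_of_int (- int (Suc k))) :: 'a::real_normed_vector set)"
proof (intro set_eqI)
  fix z :: 'a
  define l where "l = \<lfloor>log 2 (norm z / r)\<rfloor>"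
  have "norm z < r \<longleftrightarrow> (\<exists>k::nat. l = - int (Suc k))" if "z \<noteq> 0"
  proof -
    have "norm z < r \<longleftrightarrow> l < 0"
      using assms that unfolding l_def by (simp add: floor_less_iff log_less_zero_cancel_iff)
    also have "\<dots> \<longleftrightarrow> (\<exists>k::nat. l = - int (Suc k))"
      using negD[of l] by auto
    finally show ?thesis .
  qed
  then show "z \<in> ball 0 r - {0} \<longleftrightarrow> z \<in> (\<Union>k::nat. annulus (r * 2 powr real_of_int (- int (Suc k))))"
    unfolding UN_iff mem_dyadic_annulus_iff[OF assms] l_def[symmetric] by auto
qed

lemma outside_ball_eq_dyadic_annuli:
  assumes "0 < r"
  shows "{z. r \<le> norm z} = (\<Union>k::nat. annulus (r * 2 powr real_of_int (int k)) :: 'a::real_normed_vector set)"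
proof (intro set_eqI)
  fix z :: 'a
  define l where "l = \<lfloor>log 2 (norm z / r)\<rfloor>"
  have "r \<le> norm z \<longleftrightarrow> z \<noteq> 0 \<and> (\<exists>k::nat. l = int k)"
  proof (cases "z = 0")
    case False
    then have "r \<le> norm z \<longleftrightarrow> 0 \<le> l"
      using assms unfolding l_def by (simp add: le_floor_iff zero_le_log_cancel_iff)
    then show ?thesis using False zero_le_imp_eq_int[of l] by auto
  qed (use assms in simp)
  then show "z \<in> {z. r \<le> norm z} \<longleftrightarrow> z \<in> (\<Union>k::nat. annulus (r * 2 powr real_of_int (int k)))"
    unfolding UN_iff mem_dyadic_annulus_iff[OF assms] l_def[symmetric] by auto
qed

definition unit_annulus_vol :: "real \<Rightarrow> real" where
  "unit_annulus_vol n = unit_ball_vol n * (2 powr n - 1)"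

lemma unit_annulus_vol_pos: "0 < n \<Longrightarrow> 0 < unit_annulus_vol n"
  unfolding unit_annulus_vol_def by simp

lemma emeasure_annulus:
  assumes "0 \<le> t"
  shows "emeasure lborel (annulus t :: 'a::euclidean_space set)
    = ennreal (unit_annulus_vol DIM('a) * t ^ DIM('a))"
proof -
  have "emeasure lborel (annulus t :: 'a set)
      = emeasure lborel (ball (0::'a) (2 * t)) - emeasure lborel (ball (0::'a) t)"
    unfolding annulus_eq_ball_diff
    by (rule emeasure_Diff) (use assms in \<open>auto simp: subset_eq emeasure_ball\<close>)
  also have "\<dots> = ennreal (unit_ball_vol DIM('a) * (2 * t) ^ DIM('a) - unit_ball_vol DIM('a) * t ^ DIM('a))"
    using assms by (simp add: emeasure_ball ennreal_minus mult_left_mono power_mono)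
  also have "\<dots> = ennreal (unit_annulus_vol DIM('a) * t ^ DIM('a))"
    by (simp add: unit_annulus_vol_def powr_realpow power_mult_distrib algebra_simps)
  finally show ?thesis .
qed

lemma set_nn_integral_annulus_const:
  assumes "0 \<le> c" and "0 \<le> t"
  shows "(\<integral>\<^sup>+z\<in>annulus t. ennreal c \<partial>(lborel :: 'a::euclidean_space measure))
      = ennreal (c * unit_annulus_vol DIM('a) * t ^ DIM('a))"
proof -
  have "annulus t \<in> sets (lborel :: 'a measure)"
    using annulus_borel by simp
  then show ?thesis
    using assms by (simp add: nn_integral_cmult_indicator emeasure_annulus ennreal_mult' mult.assoc)
qed

lemma set_nn_integral_annulus_powr_bounds:
  fixes e t :: real
  assumes e: "e \<le> 0" and t: "0 < t"
  defines "I \<equiv> \<integral>\<^sup>+z\<in>annulus t. ennreal (norm z powr e) \<partial>(lborel :: 'a::euclidean_space measure)"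
  shows "I \<le> ennreal (unit_annulus_vol DIM('a) * t powr (DIM('a) + e))"
    and "ennreal (2 powr e * unit_annulus_vol DIM('a) * t powr (DIM('a) + e)) \<le> I"
proof -
  have tN: "t powr (DIM('a) + e) = t powr e * t ^ DIM('a)"
    using t by (simp add: powr_add powr_realpow)
  have t2: "(2 * t) powr e = 2 powr e * t powr e"
    using t by (simp add: powr_mult)
  have upper: "norm z powr e \<le> t powr e" and lower: "(2 * t) powr e \<le> norm z powr e"
    if "z \<in> annulus t" for z :: 'a
  proof -
    from that t have "t \<le> norm z" "norm z < 2 * t" "0 < norm z" by (auto simp: annulus_def)
    then show "norm z powr e \<le> t powr e" "(2 * t) powr e \<le> norm z powr e"
      using e t by (auto intro: powr_mono2')
  qed
  have "I \<le> (\<integral>\<^sup>+z\<in>annulus t. ennreal (t powr e) \<partial>(lborel :: 'a measure))"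
    unfolding I_def
    by (intro nn_integral_mono) (simp add: upper ennreal_leI split: split_indicator)
  also have "\<dots> = ennreal (unit_annulus_vol DIM('a) * t powr (DIM('a) + e))"
    using t by (subst set_nn_integral_annulus_const) (simp_all add: tN mult_ac)
  finally show "I \<le> ennreal (unit_annulus_vol DIM('a) * t powr (DIM('a) + e))" .
  have "ennreal (2 powr e * unit_annulus_vol DIM('a) * t powr (DIM('a) + e))
      = (\<integral>\<^sup>+z\<in>annulus t. ennreal ((2 * t) powr e) \<partial>(lborel :: 'a measure))"
    using t unfolding t2 by (subst set_nn_integral_annulus_const) (simp_all add: tN mult_ac)
  also have "\<dots> \<le> I"
    unfolding I_def
    by (intro nn_integral_mono) (simp add: lower ennreal_leI split: split_indicator)
  finally show "ennreal (2 powr e * unit_annulus_vol DIM('a) * t powr (DIM('a) + e)) \<le> I" .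
qed

lemma set_nn_integral_dyadic_annuli_powr_bounds:
  fixes e r S :: real and f :: "nat \<Rightarrow> int"
  assumes e: "e \<le> 0" and r: "0 < r" and f: "inj f"
    and sums: "(\<lambda>k. (r * 2 powr f k) powr (DIM('a) + e)) sums S"
  defines "I \<equiv> \<integral>\<^sup>+z\<in>(\<Union>k. annulus (r * 2 powr f k)). ennreal (norm z powr e) \<partial>(lborel :: 'a::euclidean_space measure)"
  shows "I \<le> ennreal (unit_annulus_vol DIM('a) * S)"
    and "ennreal (2 powr e * unit_annulus_vol DIM('a) * S) \<le> I"
proof -
  define t where "t k = r * 2 powr f k" for k
  have t: "0 < t k" for k
    using r by (simp add: t_def)
  have I_eq: "I = (\<Sum>k. \<integral>\<^sup>+z\<in>annulus (t k). ennreal (norm z powr e) \<partial>(lborel :: 'a measure))"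
    unfolding I_def t_def
    by (rule nn_integral_disjoint_family) (use disjoint_family_dyadic_annuli[OF r f] annulus_borel in auto)
  have series: "(\<Sum>k. ennreal (c * t k powr (DIM('a) + e))) = ennreal (c * S)" if "0 \<le> c" for c
    using that sums_mult[OF sums[folded t_def], of c] by (intro suminf_ennreal_eq) auto
  have V: "0 \<le> unit_annulus_vol DIM('a)" "0 \<le> 2 powr e * unit_annulus_vol DIM('a)"
    using unit_annulus_vol_pos[of "DIM('a)"] by simp_all
  have "I \<le> (\<Sum>k. ennreal (unit_annulus_vol DIM('a) * t k powr (DIM('a) + e)))"
    unfolding I_eq
    by (intro suminf_le summableI set_nn_integral_annulus_powr_bounds(1)[OF e t])
  also have "\<dots> = ennreal (unit_annulus_vol DIM('a) * S)"
    by (rule series[OF V(1)])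
  finally show "I \<le> ennreal (unit_annulus_vol DIM('a) * S)" .
  have "ennreal (2 powr e * unit_annulus_vol DIM('a) * S)
      = (\<Sum>k. ennreal (2 powr e * unit_annulus_vol DIM('a) * t k powr (DIM('a) + e)))"
    by (rule series[OF V(2), symmetric])
  also have "\<dots> \<le> I"
    unfolding I_eq
    by (intro suminf_le summableI set_nn_integral_annulus_powr_bounds(2)[OF e t])
  finally show "ennreal (2 powr e * unit_annulus_vol DIM('a) * S) \<le> I" .
qed

lemma sums_dyadic_powr_shrinking:
  fixes r a :: real
  assumes "0 < r" and "0 < a"
  shows "(\<lambda>k::nat. (r * 2 powr real_of_int (- int (Suc k))) powr a) sums (r powr a / (2 powr a - 1))"
proof -
  define q where "q = 1 / 2 powr a"
  have q: "0 < q" "q < 1"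
    using assms(2) by (auto simp: q_def)
  have pow: "((2::real) ^ n) powr a = (2 powr a) ^ n" for n
    by (simp add: powr_realpow[symmetric] powr_powr mult.commute)
  have "(r * 2 powr real_of_int (- int (Suc k))) powr a = r powr a * q * q ^ k" for k :: nat
  proof -
    have "(2::real) powr real_of_int (- int (Suc k)) = 1 / 2 powr real (Suc k)"
      by (simp only: of_int_minus of_int_of_nat_eq powr_minus_divide)
    also have "\<dots> = 1 / 2 ^ Suc k"
      by (simp only: powr_realpow zero_less_numeral)
    finally have "(r * 2 powr real_of_int (- int (Suc k))) powr a = r powr a / (2 ^ Suc k) powr a"
      using assms(1) by (simp add: powr_divide)
    also have "(2 ^ Suc k) powr a = (2 powr a) ^ Suc k"
      using pow .
    finally show ?thesis
      by (simp add: q_def power_one_over[symmetric] del: power_Suc) (simp add: field_simps)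
  qed
  moreover have "(\<lambda>k. r powr a * q * q ^ k) sums (r powr a * q * (1 / (1 - q)))"
    using q by (intro sums_mult geometric_sums) auto
  moreover have "r powr a * q * (1 / (1 - q)) = r powr a / (2 powr a - 1)"
    using q by (simp add: q_def field_simps)
  ultimately show ?thesis by simp
qed

lemma sums_dyadic_powr_growing:
  fixes r a :: real
  assumes "0 < r" and "a < 0"
  shows "(\<lambda>k::nat. (r * 2 powr real_of_int (int k)) powr a) sums (r powr a / (1 - 2 powr a))"
proof -
  define q where "q = 2 powr a"
  have "2 powr a < 2 powr 0"
    using assms(2) by (intro powr_less_mono) auto
  then have q: "0 < q" "q < 1"
    by (auto simp: q_def)
  have "(r * 2 powr real_of_int (int k)) powr a = r powr a * q ^ k" for k :: nat
    using assms(1) unfolding q_def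
    by (smt (verit) of_int_of_nat_eq powr_gt_zero powr_mult powr_powr_swap powr_realpow)
  moreover have "(\<lambda>k. r powr a * q ^ k) sums (r powr a * (1 / (1 - q)))"
    using q by (intro sums_mult geometric_sums) auto
  ultimately show ?thesis by (simp add: q_def)
qed

lemma set_nn_integral_ball_powr_bounds:
  fixes e r :: real
  assumes e: "e \<le> 0" and Ne: "0 < DIM('a) + e" and r: "0 < r"
  defines "I \<equiv> \<integral>\<^sup>+z\<in>ball 0 r. ennreal (norm z powr e) \<partial>(lborel :: 'a::euclidean_space measure)"
    and "S \<equiv> r powr (DIM('a) + e) / (2 powr (DIM('a) + e) - 1)"
  shows "I \<le> ennreal (unit_annulus_vol DIM('a) * S)"
    and "ennreal (2 powr e * unit_annulus_vol DIM('a) * S) \<le> I"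
proof -
  have inj: "inj (\<lambda>k::nat. - int (Suc k))"
    by (auto simp: inj_def)
  \<comment> \<open>The origin does not matter, since \<open>0 powr e = 0\<close>.\<close>
  have "I = (\<integral>\<^sup>+z\<in>ball 0 r - {0}. ennreal (norm z powr e) \<partial>(lborel :: 'a measure))"
    unfolding I_def by (intro nn_integral_cong) (simp split: split_indicator)
  then have I: "I = (\<integral>\<^sup>+z\<in>(\<Union>k::nat. annulus (r * 2 powr real_of_int (- int (Suc k)))).
      ennreal (norm z powr e) \<partial>(lborel :: 'a measure))"
    by (simp only: ball_minus_origin_eq_dyadic_annuli[OF r])
  show "I \<le> ennreal (unit_annulus_vol DIM('a) * S)"
    and "ennreal (2 powr e * unit_annulus_vol DIM('a) * S) \<le> I"
    unfolding I S_def
    using set_nn_integral_dyadic_annuli_powr_bounds[OF e r inj sums_dyadic_powr_shrinking[OF r Ne]]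
    by auto
qed

lemma set_nn_integral_outside_ball_powr_le:
  fixes e r :: real
  assumes Ne: "DIM('a) + e < 0" and r: "0 < r"
  shows "(\<integral>\<^sup>+z\<in>{z. r \<le> norm z}. ennreal (norm z powr e) \<partial>(lborel :: 'a::euclidean_space measure))
    \<le> ennreal (unit_annulus_vol DIM('a) * (r powr (DIM('a) + e) / (1 - 2 powr (DIM('a) + e))))"
proof -
  have e: "e \<le> 0"
    using Ne by linarith
  have inj: "inj (\<lambda>k::nat. int k)"
    by (auto simp: inj_def)
  show ?thesis
    unfolding outside_ball_eq_dyadic_annuli[OF r]
    by (rule set_nn_integral_dyadic_annuli_powr_bounds(1)[OF e r inj sums_dyadic_powr_growing[OF r Ne]])
qed

section \<open>The Riesz potential of a uniform density on a ball\<close>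

lemma riesz_const_pos:
  assumes "0 < s" and "s < N"
  shows "0 < riesz_const N (s / 2)"
  unfolding riesz_const_def using assms by (auto intro!: Gamma_real_pos)

lemma ball_borel [measurable]: "ball c r \<in> sets borel"
  by simp

lemma integrable_indicator_ball: "integrable lborel (indicator (ball (0::'a::euclidean_space) R) :: 'a \<Rightarrow> real)"
  by (intro integrable_real_indicator emeasure_lborel_ball_finite) simp

definition uniform_ball :: "real \<Rightarrow> real \<Rightarrow> 'a::euclidean_space \<Rightarrow> real" where
  "uniform_ball h R x = h * indicator (ball 0 R) x"

definition ball_potential :: "real \<Rightarrow> real \<Rightarrow> 'a::euclidean_space \<Rightarrow> ennreal" where
  "ball_potential R e x = (\<integral>\<^sup>+y\<in>ball 0 R. ennreal (norm (x - y) powr e) \<partial>lborel)"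

lemma ball_potential_measurable [measurable]: "ball_potential R e \<in> borel_measurable borel"
  unfolding ball_potential_def by measurable

lemma conv_riesz_uniform_ball:
  fixes x :: "'a::euclidean_space"
  shows "conv (riesz_kernel DIM('a) (s / 2)) (uniform_ball h R) x
    = riesz_const DIM('a) (s / 2) * h * enn2real (ball_potential R (s - DIM('a)) x)"
proof -
  define e where "e = s - DIM('a)"
  have "conv (riesz_kernel DIM('a) (s / 2)) (uniform_ball h R) x
      = (\<integral>y. (riesz_const DIM('a) (s / 2) * h) * (norm (x - y) powr e * indicator (ball 0 R) y) \<partial>lebesgue)"
    unfolding conv_def riesz_kernel_def uniform_ball_def e_def by (simp add: ac_simps)
  also have "\<dots> = riesz_const DIM('a) (s / 2) * h
      * (\<integral>y. norm (x - y) powr e * indicator (ball 0 R) y \<partial>lebesgue)"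
    by (rule integral_mult_right_zero)
  also have "(\<integral>y. norm (x - y) powr e * indicator (ball 0 R) y \<partial>lebesgue)
      = (\<integral>y. norm (x - y) powr e * indicator (ball 0 R) y \<partial>lborel)"
    by (rule integral_completion) measurable
  also have "(\<integral>y. norm (x - y) powr e * indicator (ball 0 R) y \<partial>lborel) = enn2real (ball_potential R e x)"
    unfolding ball_potential_def
    by (subst integral_eq_nn_integral) (auto intro!: arg_cong[where f = enn2real] nn_integral_cong split: split_indicator)
  finally show ?thesis
    unfolding e_def .
qed

lemma ball_potential_le_near:
  fixes x :: "'a::euclidean_space"
  shows "ball_potential R e x \<le> (\<integral>\<^sup>+z\<in>ball 0 (norm x + R). ennreal (norm z powr e) \<partial>(lborel :: 'a measure))"
proof -
  have "ball_potential R e x = (\<integral>\<^sup>+z\<in>ball x R. ennreal (norm z powr e) \<partial>lborel)"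
    unfolding ball_potential_def
    by (subst nn_integral_lborel_reflection[of _ x]) (auto intro!: nn_integral_cong split: split_indicator simp: dist_norm)
  also have "\<dots> \<le> (\<integral>\<^sup>+z\<in>ball 0 (norm x + R). ennreal (norm z powr e) \<partial>(lborel :: 'a measure))"
  proof (intro nn_integral_mono)
    fix z :: 'a
    have "z \<in> ball 0 (norm x + R)" if "z \<in> ball x R"
      using that norm_triangle_ineq4[of x "x - z"] by (simp add: dist_norm)
    then show "ennreal (norm z powr e) * indicator (ball x R) z
        \<le> ennreal (norm z powr e) * indicator (ball 0 (norm x + R)) z"
      by (simp split: split_indicator)
  qed
  finally show ?thesis .
qed

lemma ball_potential_ge_near:
  fixes x :: "'a::euclidean_space"
  assumes "norm x \<le> R / 2"
  shows "(\<integral>\<^sup>+z\<in>ball 0 (R / 2). ennreal (norm z powr e) \<partial>(lborel :: 'a measure)) \<le> ball_potential R e x"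
proof -
  have "(\<integral>\<^sup>+z\<in>ball 0 (R / 2). ennreal (norm z powr e) \<partial>(lborel :: 'a measure))
      \<le> (\<integral>\<^sup>+z\<in>ball x R. ennreal (norm z powr e) \<partial>lborel)"
  proof (intro nn_integral_mono)
    fix z :: 'a
    have "z \<in> ball x R" if "z \<in> ball 0 (R / 2)"
      using that assms norm_triangle_ineq4[of x z] by (simp add: dist_norm)
    then show "ennreal (norm z powr e) * indicator (ball 0 (R / 2)) z
        \<le> ennreal (norm z powr e) * indicator (ball x R) z"
      by (simp split: split_indicator)
  qed
  also have "\<dots> = ball_potential R e x"
    unfolding ball_potential_def
    by (subst nn_integral_lborel_reflection[of _ x]) (auto intro!: nn_integral_cong split: split_indicator simp: dist_norm)
  finally show ?thesis .
qed

lemma ball_potential_le_far: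
  fixes x :: "'a::euclidean_space"
  assumes e: "e \<le> 0" and R: "0 < R" and x: "2 * R \<le> norm x"
  shows "ball_potential R e x \<le> ennreal ((norm x / 2) powr e * (unit_ball_vol DIM('a) * R ^ DIM('a)))"
proof -
  have "ball_potential R e x \<le> (\<integral>\<^sup>+y\<in>ball 0 R. ennreal ((norm x / 2) powr e) \<partial>(lborel :: 'a measure))"
    unfolding ball_potential_def
  proof (intro nn_integral_mono)
    fix y :: 'a
    have "norm (x - y) powr e \<le> (norm x / 2) powr e" if "y \<in> ball 0 R"
    proof (rule powr_mono2'[OF e])
      show "0 < norm x / 2" using x R by linarith
      show "norm x / 2 \<le> norm (x - y)"
        using that x norm_triangle_ineq2[of x y] by (simp add: dist_norm)
    qed
    then show "ennreal (norm (x - y) powr e) * indicator (ball 0 R) y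
        \<le> ennreal ((norm x / 2) powr e) * indicator (ball 0 R) y"
      by (simp add: ennreal_leI split: split_indicator)
  qed
  also have "\<dots> = ennreal ((norm x / 2) powr e * (unit_ball_vol DIM('a) * R ^ DIM('a)))"
    using R by (simp add: nn_integral_cmult_indicator emeasure_ball ennreal_mult)
  finally show ?thesis .
qed

lemma ball_potential_finite:
  fixes x :: "'a::euclidean_space" and e R :: real
  assumes "e \<le> 0" and "0 < DIM('a) + e" and "0 < R"
  shows "ball_potential R e x < \<infinity>"
proof -
  have "0 < norm x + R"
    using assms(3) by (simp add: add_nonneg_pos)
  from set_nn_integral_ball_powr_bounds(1)[where 'a='a, OF assms(1,2) this]
  show ?thesis
    using ball_potential_le_near[of R e x] by (simp add: le_less_trans)
qed

lemma integrable_outside_ball_powr: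
  fixes f r :: real
  assumes "DIM('a) + f < 0" and "0 < r"
  shows "integrable lborel (\<lambda>x::'a::euclidean_space. indicator {x. r \<le> norm x} x * norm x powr f)"
proof (rule integrableI_nonneg)
  have "(\<integral>\<^sup>+x. ennreal (indicator {x. r \<le> norm x} x * norm x powr f) \<partial>(lborel :: 'a measure))
      = (\<integral>\<^sup>+x\<in>{x. r \<le> norm x}. ennreal (norm x powr f) \<partial>(lborel :: 'a measure))"
    by (intro nn_integral_cong) (simp split: split_indicator)
  also have "\<dots> < \<infinity>"
    using set_nn_integral_outside_ball_powr_le[OF assms] by (simp add: le_less_trans)
  finally show "(\<integral>\<^sup>+x. ennreal (indicator {x. r \<le> norm x} x * norm x powr f) \<partial>(lborel :: 'a measure)) < \<infinity>" .
qed auto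

lemma conv_riesz_uniform_ball_le_near:
  fixes s h R :: real and x :: "'a::euclidean_space"
  assumes s: "0 < s" "s < DIM('a)" and h: "0 \<le> h" and R: "0 < R" and x: "norm x < 2 * R"
  shows "conv (riesz_kernel DIM('a) (s / 2)) (uniform_ball h R) x \<le> riesz_const DIM('a) (s / 2) * h
    * enn2real (\<integral>\<^sup>+z\<in>ball 0 (3 * R). ennreal (norm z powr (s - DIM('a))) \<partial>(lborel :: 'a measure))"
proof -
  define e where "e = s - DIM('a)"
  have e: "e \<le> 0" "0 < DIM('a) + e"
    using s by (auto simp: e_def)
  have "ball_potential R e x \<le> (\<integral>\<^sup>+z\<in>ball 0 (3 * R). ennreal (norm z powr e) \<partial>(lborel :: 'a measure))"
    using ball_potential_le_near[of R e x] x
    by (elim order_trans, intro nn_integral_mono) (simp split: split_indicator)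
  moreover have "(\<integral>\<^sup>+z\<in>ball 0 (3 * R). ennreal (norm z powr e) \<partial>(lborel :: 'a measure)) < \<infinity>"
    using set_nn_integral_ball_powr_bounds(1)[where 'a='a, OF e, of "3 * R"] R
    by (simp add: le_less_trans)
  ultimately show ?thesis
    unfolding conv_riesz_uniform_ball e_def[symmetric] using riesz_const_pos[OF s] h
    by (intro mult_left_mono enn2real_mono) auto
qed

lemma conv_riesz_uniform_ball_le_far:
  fixes s h R :: real and x :: "'a::euclidean_space"
  assumes s: "0 < s" "s < DIM('a)" and h: "0 \<le> h" and R: "0 < R" and x: "2 * R \<le> norm x"
  shows "conv (riesz_kernel DIM('a) (s / 2)) (uniform_ball h R) x \<le> riesz_const DIM('a) (s / 2) * h
    * (unit_ball_vol DIM('a) * R ^ DIM('a)) * 2 powr (DIM('a) - s) * norm x powr (s - DIM('a))"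
proof -
  have "enn2real (ball_potential R (s - DIM('a)) x)
      \<le> (norm x / 2) powr (s - DIM('a)) * (unit_ball_vol DIM('a) * R ^ DIM('a))"
    using ball_potential_le_far[OF _ R x] s R by (intro enn2real_leI) auto
  also have "\<dots> = 2 powr (DIM('a) - s) * (unit_ball_vol DIM('a) * R ^ DIM('a)) * norm x powr (s - DIM('a))"
    by (simp add: powr_divide powr_minus_divide powr_diff)
  finally show ?thesis
    unfolding conv_riesz_uniform_ball using riesz_const_pos[OF s] h
    by (simp add: mult_left_mono mult_ac)
qed

lemma conv_riesz_uniform_ball_ge_near:
  fixes s h R :: real and x :: "'a::euclidean_space"
  assumes s: "0 < s" "s < DIM('a)" and h: "0 \<le> h" and R: "0 < R" and x: "x \<in> ball 0 (R / 2)"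
  shows "riesz_const DIM('a) (s / 2) * h * (2 powr (s - DIM('a)) * unit_annulus_vol DIM('a)
      * ((R / 2) powr s / (2 powr s - 1)))
    \<le> conv (riesz_kernel DIM('a) (s / 2)) (uniform_ball h R) x"
proof -
  define e where "e = s - DIM('a)"
  define lam where "lam = 2 powr e * unit_annulus_vol DIM('a) * ((R / 2) powr s / (2 powr s - 1))"
  have e: "e \<le> 0" "0 < DIM('a) + e"
    using s by (auto simp: e_def)
  have "2 powr 0 < 2 powr s"
    using s by (intro powr_less_mono) auto
  then have lam: "0 \<le> lam"
    using unit_annulus_vol_pos[of "DIM('a)"] by (simp add: lam_def)
  have "ennreal lam \<le> (\<integral>\<^sup>+z\<in>ball 0 (R / 2). ennreal (norm z powr e) \<partial>(lborel :: 'a measure))"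
    using set_nn_integral_ball_powr_bounds(2)[where 'a='a, OF e, of "R / 2"] R
    by (simp add: lam_def e_def mult.assoc)
  also have "\<dots> \<le> ball_potential R e x"
    using x by (intro ball_potential_ge_near) simp
  finally have "enn2real (ennreal lam) \<le> enn2real (ball_potential R e x)"
    using ball_potential_finite[OF e R] by (intro enn2real_mono) auto
  then show ?thesis
    unfolding conv_riesz_uniform_ball e_def[symmetric] lam_def[symmetric]
    using riesz_const_pos[OF s] h lam by (simp add: mult_left_mono)
qed

text \<open>The potential decays like \<open>norm x powr (s - N)\<close>, which is \<open>q\<close>-integrable at infinity
  exactly when \<open>N < (N - s) * q\<close>.\<close>

lemma integrable_uniform_ball_potential_powr:
  fixes s h R q :: real
  assumes s: "0 < s" "s < DIM('a)" and sq: "DIM('a) < (DIM('a) - s) * q"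
    and q: "0 < q" and h: "0 \<le> h" and R: "0 < R"
  shows "integrable lebesgue
    (\<lambda>x::'a::euclidean_space. conv (riesz_kernel DIM('a) (s / 2)) (uniform_ball h R) x powr q)"
proof -
  define e where "e = s - DIM('a)"
  define u where "u x = conv (riesz_kernel DIM('a) (s / 2)) (uniform_ball h R) x" for x :: 'a
  define B where "B = riesz_const DIM('a) (s / 2) * h
    * enn2real (\<integral>\<^sup>+z\<in>ball 0 (3 * R). ennreal (norm z powr e) \<partial>(lborel :: 'a measure))"
  define C where "C = riesz_const DIM('a) (s / 2) * h
    * (unit_ball_vol DIM('a) * R ^ DIM('a)) * 2 powr (DIM('a) - s)"
  have e: "DIM('a) + e * q < 0"
    using sq by (simp add: e_def algebra_simps)
  have C: "0 \<le> C"
    using riesz_const_pos[OF s] h R by (simp add: C_def)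
  have u_nonneg: "0 \<le> u x" for x
    unfolding u_def using riesz_const_pos[OF s] h
    by (simp add: conv_riesz_uniform_ball)
  define g where "g x = B powr q * indicator (ball 0 (2 * R)) x
    + C powr q * (indicator {x. 2 * R \<le> norm x} x * norm x powr (e * q))" for x :: 'a
  have bound: "u x powr q \<le> g x" for x
  proof (cases "norm x < 2 * R")
    case True
    have "u x powr q \<le> B powr q"
      using conv_riesz_uniform_ball_le_near[OF s h R True] u_nonneg q
      unfolding u_def B_def e_def by (intro powr_mono2) auto
    moreover have "x \<in> ball 0 (2 * R)" "x \<notin> {x. 2 * R \<le> norm x}"
      using True by auto
    ultimately show ?thesis
      by (simp add: g_def)
  next
    case False
    then have "u x powr q \<le> (C * norm x powr e) powr q"
      using conv_riesz_uniform_ball_le_far[OF s h R] u_nonneg q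
      unfolding u_def C_def e_def by (intro powr_mono2) auto
    also have "\<dots> = C powr q * norm x powr (e * q)"
      using C by (simp add: powr_mult powr_powr)
    finally have "u x powr q \<le> C powr q * norm x powr (e * q)" .
    moreover have "x \<notin> ball 0 (2 * R)" "x \<in> {x. 2 * R \<le> norm x}"
      using False by auto
    ultimately show ?thesis
      by (simp add: g_def)
  qed
  have "integrable lborel g"
    unfolding g_def using integrable_outside_ball_powr[where 'a='a, OF e, of "2 * R"] R
      integrable_indicator_ball[where 'a='a, of "2 * R"]
    by (intro Bochner_Integration.integrable_add Bochner_Integration.integrable_mult_right) auto
  moreover have meas: "(\<lambda>x. u x powr q) \<in> borel_measurable lborel"
    unfolding u_def conv_riesz_uniform_ball by measurable
  moreover have "AE x in lborel. norm (u x powr q) \<le> norm (g x)"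
    using bound by (intro AE_I2) (smt (verit) real_norm_def powr_ge_zero)
  ultimately have "integrable lborel (\<lambda>x. u x powr q)"
    by (rule Bochner_Integration.integrable_bound)
  then show ?thesis
    using meas by (simp add: u_def integrable_completion)
qed

lemma uniform_ball_powr:
  assumes "0 < h"
  shows "uniform_ball h R x powr m = h powr m * indicator (ball 0 R) x"
  using assms by (simp add: uniform_ball_def split: split_indicator)

lemma integral_uniform_ball_powr:
  fixes h R m :: real
  assumes "0 < h" and "0 \<le> R"
  shows "(\<integral>x. uniform_ball h R x powr m \<partial>(lebesgue :: 'a::euclidean_space measure))
    = h powr m * (unit_ball_vol DIM('a) * R ^ DIM('a))"
proof -
  have "(\<integral>x. h powr m * indicator (ball 0 R) x \<partial>(lebesgue :: 'a measure))
      = (\<integral>x. h powr m * indicator (ball 0 R) x \<partial>(lborel :: 'a measure))"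
    by (rule integral_completion) measurable
  then show ?thesis
    using assms by (simp add: uniform_ball_powr content_ball)
qed

lemma uniform_ball_admissible:
  fixes h R m :: real
  assumes h: "0 < h" and R: "0 \<le> R"
  shows "(uniform_ball h R :: 'a::euclidean_space \<Rightarrow> real)
    \<in> admissible m (h * (unit_ball_vol DIM('a) * R ^ DIM('a)))"
proof -
  have [measurable]: "(\<lambda>x::'a. uniform_ball h R x) \<in> borel_measurable lborel"
    "(\<lambda>x::'a. uniform_ball h R x powr m) \<in> borel_measurable lborel"
    "(\<lambda>x::'a. uniform_ball h R x *\<^sub>R x) \<in> borel_measurable lborel"
    unfolding uniform_ball_powr[OF h] by (simp_all add: uniform_ball_def)
  have int_mass: "integrable lborel (\<lambda>x::'a. uniform_ball h R x)"
    unfolding uniform_ball_def by (intro integrable_mult_right integrable_indicator_ball)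
  have int_powr: "integrable lborel (\<lambda>x::'a. uniform_ball h R x powr m)"
    unfolding uniform_ball_powr[OF h] by (intro integrable_mult_right integrable_indicator_ball)
  have int_moment: "integrable lborel (\<lambda>x::'a. uniform_ball h R x *\<^sub>R x)"
  proof (rule Bochner_Integration.integrable_bound)
    show "integrable lborel (\<lambda>x::'a. (h * R) * indicator (ball 0 R) x)"
      by (intro integrable_mult_right integrable_indicator_ball)
    show "AE x in lborel. norm (uniform_ball h R x *\<^sub>R x) \<le> norm ((h * R) * indicator (ball (0::'a) R) x)"
      using h R by (intro AE_I2) (auto simp: uniform_ball_def abs_mult split: split_indicator intro!: mult_left_mono)
  qed measurable
  have "(\<integral>x. uniform_ball h R x \<partial>(lebesgue :: 'a measure)) = (\<integral>x. uniform_ball h R x \<partial>(lborel :: 'a measure))"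
    by (rule integral_completion) measurable
  then have mass: "(\<integral>x. uniform_ball h R x \<partial>(lebesgue :: 'a measure)) = h * (unit_ball_vol DIM('a) * R ^ DIM('a))"
    using R by (simp add: uniform_ball_def content_ball)
  have moment: "(\<integral>x. uniform_ball h R x *\<^sub>R x \<partial>lebesgue) = (0::'a)"
    by (rule lebesgue_integral_odd) (simp add: uniform_ball_def indicator_def)
  have nonneg: "0 \<le> uniform_ball h R x" for x :: 'a
    using h by (simp add: uniform_ball_def)
  show ?thesis
    unfolding admissible_def
    using nonneg int_mass int_powr int_moment mass moment by (simp add: integrable_completion)
qed

section \<open>A test density with negative free energy\<close>

lemma integral_uniform_ball_potential_powr_ge:
  fixes s h R q :: real
  assumes s: "0 < s" "s < DIM('a)" and sq: "DIM('a) < (DIM('a) - s) * q"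
    and q: "0 < q" and h: "0 \<le> h" and R: "0 < R"
  shows "(riesz_const DIM('a) (s / 2) * h * (2 powr (s - DIM('a)) * unit_annulus_vol DIM('a)
        * ((R / 2) powr s / (2 powr s - 1)))) powr q * (unit_ball_vol DIM('a) * (R / 2) ^ DIM('a))
    \<le> (\<integral>x. conv (riesz_kernel DIM('a) (s / 2)) (uniform_ball h R) x powr q
        \<partial>(lebesgue :: 'a::euclidean_space measure))"
proof -
  define b where "b = riesz_const DIM('a) (s / 2) * h * (2 powr (s - DIM('a)) * unit_annulus_vol DIM('a)
    * ((R / 2) powr s / (2 powr s - 1)))"
  define u where "u x = conv (riesz_kernel DIM('a) (s / 2)) (uniform_ball h R) x" for x :: 'a
  have "2 powr 0 < 2 powr s"
    using s by (intro powr_less_mono) auto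
  then have b: "0 \<le> b"
    using riesz_const_pos[OF s] h unit_annulus_vol_pos[of "DIM('a)"] by (simp add: b_def)
  have "b powr q * (unit_ball_vol DIM('a) * (R / 2) ^ DIM('a))
      = (\<integral>x. b powr q * indicator (ball 0 (R / 2)) x \<partial>(lborel :: 'a measure))"
    using R by (simp add: content_ball)
  also have "\<dots> = (\<integral>x. b powr q * indicator (ball 0 (R / 2)) x \<partial>(lebesgue :: 'a measure))"
    by (rule integral_completion[symmetric]) measurable
  also have "\<dots> \<le> (\<integral>x. u x powr q \<partial>lebesgue)"
  proof (rule integral_mono)
    show "integrable lebesgue (\<lambda>x::'a. b powr q * indicator (ball 0 (R / 2)) x)"
      by (simp add: integrable_completion integrable_indicator_ball)
    show "integrable lebesgue (\<lambda>x. u x powr q)"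
      unfolding u_def by (rule integrable_uniform_ball_potential_powr[OF s sq q h R])
    show "b powr q * indicator (ball 0 (R / 2)) x \<le> u x powr q" for x
      using conv_riesz_uniform_ball_ge_near[OF s h R, of x] b q
      by (auto simp: u_def b_def split: split_indicator intro: powr_mono2)
  qed
  finally show ?thesis
    unfolding u_def b_def .
qed

lemma tendsto_riesz_const_div_two_powr_minus_one:
  fixes N :: real
  assumes N: "0 < N"
  shows "((\<lambda>s. riesz_const N (s / 2) / (2 powr s - 1))
    \<longlongrightarrow> pi powr (- N / 2) * Gamma (N / 2) / (2 * ln 2)) (at_right 0)"
proof -
  \<comment> \<open>By \<open>\<Gamma>(s/2 + 1) = s/2 \<Gamma>(s/2)\<close>, \<open>riesz_const N (s/2) = g s * s/2\<close> with \<open>g\<close> continuous at \<open>0\<close>.\<close>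
  define g where "g s = pi powr (- N / 2) * 2 powr (- s) * Gamma (N / 2 - s / 2) / Gamma (s / 2 + 1)" for s
  have "isCont g 0"
    unfolding g_def using N by (intro continuous_intros isCont_Gamma) (auto simp: nonpos_Ints_def)
  then have "(g \<longlongrightarrow> pi powr (- N / 2) * Gamma (N / 2)) (at_right 0)"
    by (auto simp: g_def isCont_def intro: tendsto_within_subset)
  moreover have "((\<lambda>s::real. (s / 2) / (2 powr s - 1)) \<longlongrightarrow> inverse (ln 2) / 2) (at_right 0)"
    by real_asymp
  ultimately have lim: "((\<lambda>s. g s * ((s / 2) / (2 powr s - 1)))
      \<longlongrightarrow> pi powr (- N / 2) * Gamma (N / 2) * (inverse (ln 2) / 2)) (at_right 0)"
    by (rule tendsto_mult)
  have ev: "\<forall>\<^sub>F s in at_right 0. g s * ((s / 2) / (2 powr s - 1)) = riesz_const N (s / 2) / (2 powr s - 1)"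
  proof (rule eventually_at_rightI[of 0 1])
    fix s :: real
    assume "s \<in> {0<..<1}"
    then have nonpos: "s / 2 \<notin> \<int>\<^sub>\<le>\<^sub>0"
      by (auto elim!: nonpos_Ints_cases)
    have G: "Gamma (s / 2 + 1) = s / 2 * Gamma (s / 2)" and "Gamma (s / 2) \<noteq> 0"
      using Gamma_plus1[OF nonpos] nonpos by (simp_all add: Gamma_eq_zero_iff)
    moreover have "s \<noteq> 0" "2 powr s \<noteq> 1"
      using \<open>s \<in> {0<..<1}\<close> by auto
    ultimately show "g s * ((s / 2) / (2 powr s - 1)) = riesz_const N (s / 2) / (2 powr s - 1)"
      unfolding g_def riesz_const_def G by (simp add: field_simps)
  qed simp
  have "pi powr (- N / 2) * Gamma (N / 2) * (inverse (ln 2) / 2) = pi powr (- N / 2) * Gamma (N / 2) / (2 * ln 2)"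
    by (simp add: field_simps)
  then show ?thesis
    using tendsto_cong[OF ev] lim by (simp only:)
qed

lemma uniform_ball_interaction_lower_bound:
  fixes s h R p k :: real
  assumes p: "1 < p" and s: "0 < s" "s * p < DIM('a)" and h: "0 \<le> h" and R: "0 < R"
    and k: "0 \<le> k" "k \<le> riesz_const DIM('a) (s / 2) / (2 powr s - 1)"
    and R_s: "1 / 2 \<le> (R / 2) powr s"
  shows "(h * (k * 2 powr (- real DIM('a)) * unit_annulus_vol DIM('a) / 2)) powr conj_exp p
      * (unit_ball_vol DIM('a) * (R / 2) ^ DIM('a))
    \<le> (\<integral>x. conv (riesz_kernel DIM('a) (s / 2)) (uniform_ball h R) x powr conj_exp p
        \<partial>(lebesgue :: 'a::euclidean_space measure))"
proof -
  have sN: "s < DIM('a)"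
    using s p by (smt (verit) mult_less_cancel_left1)
  have sq: "DIM('a) < (DIM('a) - s) * conj_exp p"
    using less_mult_conj_exp_iff[OF p] s by simp
  have q: "0 < conj_exp p"
    using conj_exp_gt_one[OF p] by simp
  have V: "0 \<le> unit_annulus_vol DIM('a)"
    using unit_annulus_vol_pos[of "DIM('a)"] by simp
  define \<kappa> where "\<kappa> = riesz_const DIM('a) (s / 2) / (2 powr s - 1)"
  have "k * 2 powr (- real DIM('a)) * (1 / 2) \<le> \<kappa> * 2 powr (s - DIM('a)) * (R / 2) powr s"
    using k R_s s unfolding \<kappa>_def[symmetric]
    by (intro mult_mono powr_mono mult_nonneg_nonneg) auto
  then have "(h * unit_annulus_vol DIM('a)) * (k * 2 powr (- real DIM('a)) * (1 / 2))
      \<le> (h * unit_annulus_vol DIM('a)) * (\<kappa> * 2 powr (s - DIM('a)) * (R / 2) powr s)"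
    using h V by (intro mult_left_mono) auto
  then have "h * (k * 2 powr (- real DIM('a)) * unit_annulus_vol DIM('a) / 2)
      \<le> riesz_const DIM('a) (s / 2) * h * (2 powr (s - DIM('a)) * unit_annulus_vol DIM('a)
        * ((R / 2) powr s / (2 powr s - 1)))"
    by (simp add: \<kappa>_def mult_ac)
  then have "(h * (k * 2 powr (- real DIM('a)) * unit_annulus_vol DIM('a) / 2)) powr conj_exp p
      \<le> (riesz_const DIM('a) (s / 2) * h * (2 powr (s - DIM('a)) * unit_annulus_vol DIM('a)
        * ((R / 2) powr s / (2 powr s - 1)))) powr conj_exp p"
    using h k V q by (intro powr_mono2) auto
  then show ?thesis
    by (rule order_trans[OF mult_right_mono integral_uniform_ball_potential_powr_ge[OF s(1) sN sq q h R]])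
       (simp add: R less_imp_le)
qed

lemma free_energy_uniform_ball_le:
  fixes s h R p k m chi M :: real
  assumes p: "1 < p" and s: "0 < s" "s * p < DIM('a)" and h: "0 < h" and R: "0 < R"
    and k: "0 \<le> k" "k \<le> riesz_const DIM('a) (s / 2) / (2 powr s - 1)"
    and R_s: "1 / 2 \<le> (R / 2) powr s" and chi: "0 \<le> chi"
    and mass: "h * (unit_ball_vol DIM('a) * R ^ DIM('a)) = M"
  shows "free_energy m chi s p (uniform_ball h R :: 'a::euclidean_space \<Rightarrow> real)
    \<le> M * h powr (m - 1) / (m - 1) - chi / conj_exp p * (M * h powr (conj_exp p - 1)
        * ((k * 2 powr (- real DIM('a)) * unit_annulus_vol DIM('a) / 2) powr conj_exp p
           * 2 powr (- real DIM('a))))"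
proof -
  define q where "q = conj_exp p"
  define a where "a = k * 2 powr (- real DIM('a)) * unit_annulus_vol DIM('a) / 2"
  have a: "0 \<le> a"
    using k unit_annulus_vol_pos[of "DIM('a)"] by (simp add: a_def)
  have q: "0 < q"
    using conj_exp_gt_one[OF p] by (simp add: q_def)
  have vol: "unit_ball_vol DIM('a) * R ^ DIM('a) = M / h"
    using mass h by (simp add: field_simps)
  have "(\<integral>x. uniform_ball h R x powr m \<partial>(lebesgue :: 'a measure)) = M * h powr (m - 1)"
    using integral_uniform_ball_powr[where 'a='a, OF h, of R m] R h by (simp add: vol powr_diff)
  moreover have "M * h powr (q - 1) * (a powr q * 2 powr (- real DIM('a)))
      \<le> (\<integral>x. conv (riesz_kernel DIM('a) (s / 2)) (uniform_ball h R) x powr q \<partial>(lebesgue :: 'a measure))"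
  proof -
    have "(2::real) ^ DIM('a) = 2 powr real DIM('a)"
      by (simp add: powr_realpow)
    then have "unit_ball_vol DIM('a) * (R / 2) ^ DIM('a) = M / h / 2 powr real DIM('a)"
      by (simp add: power_divide vol[symmetric])
    also have "\<dots> = M / h * 2 powr (- real DIM('a))"
      by (simp add: powr_minus_divide)
    finally have vol2: "unit_ball_vol DIM('a) * (R / 2) ^ DIM('a) = M / h * 2 powr (- real DIM('a))" .
    have "h powr (q - 1) = h powr q / h"
      using h by (simp add: powr_diff)
    then have "M * h powr (q - 1) * (a powr q * 2 powr (- real DIM('a)))
        = (h * a) powr q * (unit_ball_vol DIM('a) * (R / 2) ^ DIM('a))"
      using h a unfolding vol2 by (simp add: powr_mult)
    also have "\<dots> \<le> (\<integral>x. conv (riesz_kernel DIM('a) (s / 2)) (uniform_ball h R) x powr q \<partial>(lebesgue :: 'a measure))"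
      unfolding a_def q_def by (rule uniform_ball_interaction_lower_bound[where 'a='a, OF p s less_imp_le[OF h] R k R_s])
    finally show ?thesis .
  qed
  ultimately show ?thesis
    unfolding free_energy_def q_def[symmetric] a_def[symmetric]
    using chi q by (simp add: divide_right_mono mult_left_mono)
qed

lemma eventually_free_energy_uniform_ball_le:
  fixes p m chi M h R :: real
  defines "k \<equiv> pi powr (- real DIM('a) / 2) * Gamma (real DIM('a) / 2) / (4 * ln 2)"
  assumes p: "1 < p" and h: "0 < h" and R: "0 < R" and chi: "0 \<le> chi"
    and mass: "h * (unit_ball_vol DIM('a) * R ^ DIM('a)) = M"
  shows "\<forall>\<^sub>F s in at_right 0. free_energy m chi s p (uniform_ball h R :: 'a::euclidean_space \<Rightarrow> real)
    \<le> M * h powr (m - 1) / (m - 1) - chi / conj_exp p * (M * h powr (conj_exp p - 1)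
        * ((k * 2 powr (- real DIM('a)) * unit_annulus_vol DIM('a) / 2) powr conj_exp p
           * 2 powr (- real DIM('a))))"
proof -
  have k: "0 < k"
    using Gamma_real_pos[of "real DIM('a) / 2"] by (simp add: k_def)
  have k2: "2 * k = pi powr (- real DIM('a) / 2) * Gamma (real DIM('a) / 2) / (2 * ln 2)"
    by (simp add: k_def)
  have "\<forall>\<^sub>F s in at_right 0. s < DIM('a) / p"
    using p by (intro order_tendstoD(2)[OF tendsto_ident_at]) simp
  moreover have "((\<lambda>s. riesz_const DIM('a) (s / 2) / (2 powr s - 1)) \<longlongrightarrow> 2 * k) (at_right 0)"
    unfolding k2 by (rule tendsto_riesz_const_div_two_powr_minus_one) simp
  then have "\<forall>\<^sub>F s in at_right 0. k < riesz_const DIM('a) (s / 2) / (2 powr s - 1)"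
    using k by (intro order_tendstoD(1)) auto
  moreover have "((\<lambda>s. (R / 2) powr s) \<longlongrightarrow> (R / 2) powr 0) (at_right 0)"
    using R by (intro tendsto_intros) auto
  then have "\<forall>\<^sub>F s in at_right 0. 1 / 2 < (R / 2) powr s"
    using R by (intro order_tendstoD(1)) auto
  ultimately show ?thesis
    using eventually_at_right_less
  proof eventually_elim
    case (elim s)
    then have "s * p < DIM('a)"
      using p by (simp add: pos_less_divide_eq)
    then show ?case
      using free_energy_uniform_ball_le[OF p \<open>0 < s\<close> _ h R less_imp_le[OF k] _ _ chi mass] elim
      by simp
  qed
qed

lemma exists_admissible_negative_free_energy:
  fixes p m chi M :: real
  assumes p: "1 < p" and m: "conj_exp p < m" and chi: "0 < chi" and M: "0 < M"
  obtains \<sigma> :: "'a::euclidean_space \<Rightarrow> real" and c :: real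
  where "\<sigma> \<in> admissible m M" and "0 < c"
    and "\<forall>\<^sub>F s in at_right 0. free_energy m chi s p \<sigma> \<le> - c"
proof -
  define q where "q = conj_exp p"
  have q: "1 < q" "q < m"
    using conj_exp_gt_one[OF p] m by (simp_all add: q_def)
  define k where "k = pi powr (- real DIM('a) / 2) * Gamma (real DIM('a) / 2) / (4 * ln 2)"
  define A where "A = (k * 2 powr (- real DIM('a)) * unit_annulus_vol DIM('a) / 2) powr q
    * 2 powr (- real DIM('a))"
  have "0 < k"
    using Gamma_real_pos[of "real DIM('a) / 2"] by (simp add: k_def)
  then have A: "0 < A"
    using unit_annulus_vol_pos[of "DIM('a)"] by (simp add: A_def)
  \<comment> \<open>The height is chosen so that the entropy term is half of the interaction term.\<close>
  define h where "h = ((m - 1) * chi * A / (2 * q)) powr (1 / (m - q))"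
  have h: "0 < h" and h_pow: "h powr (m - q) = (m - 1) * chi * A / (2 * q)"
    using q chi A by (simp_all add: h_def powr_powr)
  have "0 < unit_ball_vol DIM('a)"
    by simp
  then have ball_vol: "unit_ball_vol DIM('a) \<noteq> 0"
    by (metis less_irrefl)
  define R where "R = (M / (h * unit_ball_vol DIM('a))) powr (1 / DIM('a))"
  have R: "0 < R"
    using M h ball_vol by (simp add: R_def)
  have mass: "h * (unit_ball_vol DIM('a) * R ^ DIM('a)) = M"
    using M h ball_vol by (simp add: R_def powr_powr powr_realpow[symmetric])
  have hm: "h powr (m - 1) = h powr (q - 1) * ((m - 1) * chi * A / (2 * q))"
    unfolding h_pow[symmetric] by (simp add: powr_add[symmetric])
  have energy: "M * h powr (m - 1) / (m - 1) - chi / q * (M * h powr (q - 1) * A)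
      = - (chi / q * M * h powr (q - 1) * A / 2)"
    unfolding hm using q by (simp add: field_simps)
  show ?thesis
  proof (rule that)
    show "(uniform_ball h R :: 'a \<Rightarrow> real) \<in> admissible m M"
      using uniform_ball_admissible[where 'a='a, OF h less_imp_le[OF R], of m] mass by simp
    show "0 < chi / q * M * h powr (q - 1) * A / 2"
      using chi q M h A by simp
    have "\<forall>\<^sub>F s in at_right 0. free_energy m chi s p (uniform_ball h R :: 'a \<Rightarrow> real)
        \<le> M * h powr (m - 1) / (m - 1) - chi / q * (M * h powr (q - 1) * A)"
      using eventually_free_energy_uniform_ball_le[where 'a='a, OF p h R less_imp_le[OF chi] mass, of m]
      unfolding A_def k_def q_def .
    then show "\<forall>\<^sub>F s in at_right 0. free_energy m chi s p (uniform_ball h R :: 'a \<Rightarrow> real)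
        \<le> - (chi / q * M * h powr (q - 1) * A / 2)"
      unfolding energy .
  qed
qed

section \<open>Dilations and the virial identity\<close>

definition dilate :: "real \<Rightarrow> ('a::euclidean_space \<Rightarrow> real) \<Rightarrow> 'a \<Rightarrow> real" where
  "dilate l \<rho> x = l ^ DIM('a) * \<rho> (l *\<^sub>R x)"

lemma dilate_1 [simp]: "dilate 1 \<rho> = \<rho>"
  by (simp add: dilate_def fun_eq_iff)

lemma dilate_admissible:
  assumes adm: "\<rho> \<in> admissible m M" and l: "0 < l"
  shows "dilate l \<rho> \<in> admissible m M"
proof -
  from adm have nonneg: "\<And>x. 0 \<le> \<rho> x" and int_mass: "integrable lebesgue \<rho>"
    and int_powr: "integrable lebesgue (\<lambda>x. \<rho> x powr m)" and mass: "(\<integral>x. \<rho> x \<partial>lebesgue) = M"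
    and int_moment: "integrable lebesgue (\<lambda>x. \<rho> x *\<^sub>R x)" and moment: "(\<integral>x. \<rho> x *\<^sub>R x \<partial>lebesgue) = 0"
    unfolding admissible_def by auto
  have l0: "l \<noteq> 0"
    using l by simp
  have powr_eq: "dilate l \<rho> x powr m = (l ^ DIM('a)) powr m * \<rho> (l *\<^sub>R x) powr m" for x
    using nonneg l by (simp add: dilate_def powr_mult)
  have moment_eq: "dilate l \<rho> x *\<^sub>R x = (l ^ DIM('a) / l) *\<^sub>R (\<rho> (l *\<^sub>R x) *\<^sub>R (l *\<^sub>R x))" for x
    using l by (simp add: dilate_def)
  show ?thesis
    unfolding admissible_def
  proof (intro CollectI conjI allI)
    show "0 \<le> dilate l \<rho> x" for x
      using nonneg l by (simp add: dilate_def)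
    show "integrable lebesgue (dilate l \<rho>)"
      using int_mass integrable_dilation_iff[OF l0, of \<rho>] unfolding dilate_def
      by (intro integrable_mult_right) simp
    show "integrable lebesgue (\<lambda>x. dilate l \<rho> x powr m)"
      using int_powr integrable_dilation_iff[OF l0, of "\<lambda>x. \<rho> x powr m"] unfolding powr_eq
      by (intro integrable_mult_right) simp
    show "integrable lebesgue (\<lambda>x. dilate l \<rho> x *\<^sub>R x)"
      using int_moment integrable_dilation_iff[OF l0, of "\<lambda>x. \<rho> x *\<^sub>R x"] unfolding moment_eq
      by (intro integrable_scaleR_right) simp
    show "(\<integral>x. dilate l \<rho> x \<partial>lebesgue) = M"
      using mass l by (simp add: dilate_def integral_dilation[OF l0, of \<rho>])
    have "(\<integral>x. dilate l \<rho> x *\<^sub>R x \<partial>lebesgue)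
        = (l ^ DIM('a) / l) *\<^sub>R (\<integral>x. \<rho> (l *\<^sub>R x) *\<^sub>R (l *\<^sub>R x) \<partial>lebesgue)"
      unfolding moment_eq by (rule integral_scaleR_right)
    also have "(\<integral>x. \<rho> (l *\<^sub>R x) *\<^sub>R (l *\<^sub>R x) \<partial>lebesgue) = 0"
      using integral_dilation[OF l0, of "\<lambda>x. \<rho> x *\<^sub>R x"] moment by simp
    finally show "(\<integral>x. dilate l \<rho> x *\<^sub>R x \<partial>lebesgue) = 0"
      by simp
  qed
qed

lemma conv_riesz_dilate:
  fixes \<rho> :: "'a::euclidean_space \<Rightarrow> real" and s l :: real
  assumes l: "0 < l"
  shows "conv (riesz_kernel DIM('a) (s / 2)) (dilate l \<rho>) x
    = l powr (DIM('a) - s) * conv (riesz_kernel DIM('a) (s / 2)) \<rho> (l *\<^sub>R x)"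
proof -
  define K :: "'a \<Rightarrow> real" where "K = riesz_kernel DIM('a) (s / 2)"
  have K: "K (x - (1 / l) *\<^sub>R u) = l powr (DIM('a) - s) * K (l *\<^sub>R x - u)" for u
  proof -
    have "x - (1 / l) *\<^sub>R u = (1 / l) *\<^sub>R (l *\<^sub>R x - u)"
      using l by (simp add: algebra_simps)
    then have "norm (x - (1 / l) *\<^sub>R u) powr (s - DIM('a))
        = l powr (DIM('a) - s) * norm (l *\<^sub>R x - u) powr (s - DIM('a))"
      using l by (simp add: powr_divide powr_minus_divide powr_diff)
    then show ?thesis
      by (simp add: K_def riesz_kernel_def)
  qed
  have "conv K (dilate l \<rho>) x = (\<integral>y. l ^ DIM('a) * (K (x - y) * \<rho> (l *\<^sub>R y)) \<partial>lebesgue)"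
    unfolding conv_def dilate_def by (rule Bochner_Integration.integral_cong) (simp_all add: ac_simps)
  also have "\<dots> = l ^ DIM('a) * (\<integral>y. K (x - y) * \<rho> (l *\<^sub>R y) \<partial>lebesgue)"
    by (rule integral_mult_right_zero)
  also have "(\<integral>y. K (x - y) * \<rho> (l *\<^sub>R y) \<partial>lebesgue)
      = (1 / l ^ DIM('a)) * (\<integral>u. K (x - (1 / l) *\<^sub>R u) * \<rho> u \<partial>lebesgue)"
    using integral_dilation[of l "\<lambda>u. K (x - (1 / l) *\<^sub>R u) * \<rho> u"] l by simp
  also have "l ^ DIM('a) * ((1 / l ^ DIM('a)) * (\<integral>u. K (x - (1 / l) *\<^sub>R u) * \<rho> u \<partial>lebesgue))
      = (\<integral>u. K (x - (1 / l) *\<^sub>R u) * \<rho> u \<partial>lebesgue)"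
    using l by simp
  also have "\<dots> = l powr (DIM('a) - s) * conv K \<rho> (l *\<^sub>R x)"
    by (simp add: conv_def K mult.assoc)
  finally show ?thesis
    unfolding K_def .
qed

lemma conv_riesz_nonneg:
  fixes \<rho> :: "'a::euclidean_space \<Rightarrow> real" and s :: real
  assumes "\<And>x. 0 \<le> \<rho> x" and "0 < s" and "s < DIM('a)"
  shows "0 \<le> conv (riesz_kernel DIM('a) (s / 2)) \<rho> x"
  unfolding conv_def riesz_kernel_def
  using assms riesz_const_pos[of s "DIM('a)"] by (intro Bochner_Integration.integral_nonneg) auto

lemma free_energy_dilate:
  fixes \<rho> :: "'a::euclidean_space \<Rightarrow> real" and s l m chi p :: real
  assumes nonneg: "\<And>x. 0 \<le> \<rho> x" and l: "0 < l" and s: "0 < s" "s < DIM('a)"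
  shows "free_energy m chi s p (dilate l \<rho>)
    = l powr (DIM('a) * (m - 1)) * (1 / (m - 1) * (\<integral>x. \<rho> x powr m \<partial>lebesgue))
      - chi / conj_exp p * (l powr ((DIM('a) - s) * conj_exp p - DIM('a))
          * (\<integral>x. conv (riesz_kernel DIM('a) (s / 2)) \<rho> x powr conj_exp p \<partial>lebesgue))"
proof -
  define q where "q = conj_exp p"
  define v where "v = conv (riesz_kernel DIM('a) (s / 2)) \<rho>"
  have l_pow: "l ^ DIM('a) = l powr DIM('a)"
    using l by (simp add: powr_realpow)
  have "(\<integral>x. dilate l \<rho> x powr m \<partial>lebesgue)
      = (\<integral>x. l powr (DIM('a) * m) * \<rho> (l *\<^sub>R x) powr m \<partial>lebesgue)"
    using nonneg l by (simp add: dilate_def l_pow powr_mult powr_powr)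
  also have "\<dots> = l powr (DIM('a) * m) * (l powr (- real DIM('a)) * (\<integral>x. \<rho> x powr m \<partial>lebesgue))"
    using integral_dilation_pos[OF l, of "\<lambda>x. \<rho> x powr m"] by simp
  also have "\<dots> = l powr (DIM('a) * (m - 1)) * (\<integral>x. \<rho> x powr m \<partial>lebesgue)"
    by (simp add: powr_add[symmetric] algebra_simps)
  finally have entropy: "(\<integral>x. dilate l \<rho> x powr m \<partial>lebesgue)
      = l powr (DIM('a) * (m - 1)) * (\<integral>x. \<rho> x powr m \<partial>lebesgue)" .
  have "(\<integral>x. conv (riesz_kernel DIM('a) (s / 2)) (dilate l \<rho>) x powr q \<partial>lebesgue)
      = (\<integral>x. l powr ((DIM('a) - s) * q) * v (l *\<^sub>R x) powr q \<partial>lebesgue)"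
    using l conv_riesz_nonneg[OF nonneg s]
    by (simp add: conv_riesz_dilate v_def powr_mult powr_powr)
  also have "\<dots> = l powr ((DIM('a) - s) * q) * (l powr (- real DIM('a)) * (\<integral>x. v x powr q \<partial>lebesgue))"
    using integral_dilation_pos[OF l, of "\<lambda>x. v x powr q"] by simp
  also have "\<dots> = l powr ((DIM('a) - s) * q - DIM('a)) * (\<integral>x. v x powr q \<partial>lebesgue)"
    by (simp add: powr_add[symmetric])
  finally have interaction: "(\<integral>x. conv (riesz_kernel DIM('a) (s / 2)) (dilate l \<rho>) x powr q \<partial>lebesgue)
      = l powr ((DIM('a) - s) * q - DIM('a)) * (\<integral>x. v x powr q \<partial>lebesgue)" .
  show ?thesis
    unfolding free_energy_def q_def[symmetric] entropy interaction v_def by simp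
qed

lemma virial_identity:
  fixes \<rho> :: "'a::euclidean_space \<Rightarrow> real" and s m chi p M :: real
  assumes adm: "\<rho> \<in> admissible m M"
    and min: "\<forall>\<sigma>::'a \<Rightarrow> real\<in>admissible m M. free_energy m chi s p \<rho> \<le> free_energy m chi s p \<sigma>"
    and s: "0 < s" "s < DIM('a)" and m: "1 < m" and p: "1 < p"
  shows "DIM('a) * (\<integral>x. \<rho> x powr m \<partial>lebesgue)
    = chi / conj_exp p * ((DIM('a) - s) * conj_exp p - DIM('a))
      * (\<integral>x. conv (riesz_kernel DIM('a) (s / 2)) \<rho> x powr conj_exp p \<partial>lebesgue)"
proof -
  define q where "q = conj_exp p"
  define A where "A = (\<integral>x. \<rho> x powr m \<partial>lebesgue)"
  define B where "B = (\<integral>x. conv (riesz_kernel DIM('a) (s / 2)) \<rho> x powr q \<partial>lebesgue)"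
  define \<phi> where "\<phi> l = l powr (DIM('a) * (m - 1)) * (1 / (m - 1) * A)
    - chi / q * (l powr ((DIM('a) - s) * q - DIM('a)) * B)" for l
  have nonneg: "\<And>x. 0 \<le> \<rho> x"
    using adm by (simp add: admissible_def)
  have \<phi>: "free_energy m chi s p (dilate l \<rho>) = \<phi> l" if "0 < l" for l
    unfolding \<phi>_def A_def B_def q_def by (rule free_energy_dilate[OF nonneg that s])
  have "q \<noteq> 0"
    using conj_exp_gt_one[OF p] by (simp add: q_def)
  then have "(\<phi> has_real_derivative
      DIM('a) * (m - 1) * (1 / (m - 1) * A) - chi / q * (((DIM('a) - s) * q - DIM('a)) * B)) (at 1)"
    unfolding \<phi>_def using m by (auto intro!: derivative_eq_intros)
  \<comment> \<open>Dilations preserve the constraints, so \<open>\<phi>\<close> has a local minimum at \<open>1\<close>.\<close>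
  moreover have "\<phi> 1 \<le> \<phi> l" if "\<bar>1 - l\<bar> < 1" for l
  proof -
    have l: "0 < l"
      using that by simp
    have "\<phi> 1 = free_energy m chi s p \<rho>"
      using \<phi>[of 1] by simp
    also have "\<dots> \<le> free_energy m chi s p (dilate l \<rho>)"
      using min dilate_admissible[OF adm l] by blast
    finally show ?thesis
      using \<phi>[OF l] by simp
  qed
  ultimately have "DIM('a) * (m - 1) * (1 / (m - 1) * A) - chi / q * (((DIM('a) - s) * q - DIM('a)) * B) = 0"
    by (intro DERIV_local_min[of _ _ 1 1]) auto
  moreover have "DIM('a) * (m - 1) * (1 / (m - 1) * A) = DIM('a) * A"
    using m by simp
  ultimately have "DIM('a) * A = chi / q * (((DIM('a) - s) * q - DIM('a)) * B)"
    by linarith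
  then show ?thesis
    unfolding A_def B_def q_def by (simp only: mult.assoc)
qed

lemma minimizer_Lm_integral_ge:
  fixes \<rho> :: "'a::euclidean_space \<Rightarrow> real" and s m chi p M c :: real
  assumes adm: "\<rho> \<in> admissible m M"
    and min: "\<forall>\<sigma>::'a \<Rightarrow> real\<in>admissible m M. free_energy m chi s p \<rho> \<le> free_energy m chi s p \<sigma>"
    and s: "0 < s" "s * p < DIM('a)" and m: "1 < m" and p: "1 < p"
    and F: "free_energy m chi s p \<rho> \<le> - c"
  shows "c * ((DIM('a) - s) * conj_exp p - DIM('a)) \<le> DIM('a) * (\<integral>x. \<rho> x powr m \<partial>lebesgue)"
proof -
  define \<beta> where "\<beta> = (DIM('a) - s) * conj_exp p - DIM('a)"
  define A where "A = (\<integral>x. \<rho> x powr m \<partial>lebesgue)"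
  have \<beta>: "0 < \<beta>"
    using less_mult_conj_exp_iff[OF p] s by (simp add: \<beta>_def)
  have "s < DIM('a)"
    using s p by (smt (verit) mult_less_cancel_left1)
  then have virial: "\<beta> * (chi / conj_exp p
      * (\<integral>x. conv (riesz_kernel DIM('a) (s / 2)) \<rho> x powr conj_exp p \<partial>lebesgue)) = DIM('a) * A"
    using virial_identity[OF adm min s(1) _ m p] by (simp add: \<beta>_def A_def mult_ac)
  have "0 \<le> A"
    unfolding A_def by (intro Bochner_Integration.integral_nonneg) simp
  then have "0 \<le> \<beta> * (A / (m - 1))"
    using \<beta> m by simp
  moreover have "\<beta> * free_energy m chi s p \<rho> \<le> \<beta> * - c"
    using F \<beta> by (intro mult_left_mono) auto
  ultimately show ?thesis
    using virial unfolding free_energy_def \<beta>_def[symmetric] A_def[symmetric]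
    by (simp add: algebra_simps)
qed

lemma eventually_minimizer_Lm_integral_ge:
  fixes \<rho> :: "real \<Rightarrow> 'a::euclidean_space \<Rightarrow> real" and p m chi M c :: real
  assumes p: "1 < p" and m: "1 < m"
    and min: "\<forall>s\<in>{0<..<real DIM('a) / p}. \<rho> s \<in> admissible m M \<and>
           (\<forall>\<sigma>::'a \<Rightarrow> real\<in>admissible m M. free_energy m chi s p (\<rho> s) \<le> free_energy m chi s p \<sigma>)"
    and F: "\<forall>\<^sub>F s in at_right 0. free_energy m chi s p (\<rho> s) \<le> - c" and c: "0 \<le> c"
  shows "\<forall>\<^sub>F s in at_right 0. c * (conj_exp p - 1) / 2 \<le> (\<integral>x. \<rho> s x powr m \<partial>lebesgue)"
proof -
  define q where "q = conj_exp p"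
  have q: "1 < q"
    using conj_exp_gt_one[OF p] by (simp add: q_def)
  have "\<forall>\<^sub>F s in at_right 0. s < DIM('a) / p"
    using p by (intro order_tendstoD(2)[OF tendsto_ident_at]) simp
  moreover have "\<forall>\<^sub>F s in at_right 0. s < DIM('a) * (q - 1) / (2 * q)"
    using q by (intro order_tendstoD(2)[OF tendsto_ident_at]) simp
  ultimately show ?thesis
    using F eventually_at_right_less
  proof eventually_elim
    case (elim s)
    then have "s \<in> {0<..<real DIM('a) / p}" and sp: "s * p < DIM('a)"
      using p by (simp_all add: pos_less_divide_eq)
    then have Lm: "c * ((DIM('a) - s) * q - DIM('a)) \<le> DIM('a) * (\<integral>x. \<rho> s x powr m \<partial>lebesgue)"
      using minimizer_Lm_integral_ge[OF _ _ _ sp m p] min elim unfolding q_def by blast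
    have "DIM('a) * (q - 1) / 2 \<le> (DIM('a) - s) * q - DIM('a)"
      using elim q by (simp add: field_simps)
    then have "c * (DIM('a) * (q - 1) / 2) \<le> c * ((DIM('a) - s) * q - DIM('a))"
      using c by (rule mult_left_mono)
    moreover have "DIM('a) * (c * (q - 1) / 2) = c * (DIM('a) * (q - 1) / 2)"
      by simp
    ultimately have "DIM('a) * (c * (q - 1) / 2) \<le> DIM('a) * (\<integral>x. \<rho> s x powr m \<partial>lebesgue)"
      using Lm by linarith
    then show ?case
      unfolding q_def[symmetric] by (simp add: mult_le_cancel_left_pos)
  qed
qed

lemma eventually_minimizer_free_energy_le:
  fixes \<rho> :: "real \<Rightarrow> 'a::euclidean_space \<Rightarrow> real" and p m chi M :: real
  assumes "1 < p" and "conj_exp p < m" and "0 < chi" and "0 < M"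
    and min: "\<forall>s\<in>{0<..<real DIM('a) / p}. \<rho> s \<in> admissible m M \<and>
           (\<forall>\<sigma>::'a \<Rightarrow> real\<in>admissible m M. free_energy m chi s p (\<rho> s) \<le> free_energy m chi s p \<sigma>)"
  obtains c where "0 < c" and "\<forall>\<^sub>F s in at_right 0. free_energy m chi s p (\<rho> s) \<le> - c"
proof -
  obtain \<sigma> :: "'a \<Rightarrow> real" and c where \<sigma>: "\<sigma> \<in> admissible m M" and c: "0 < c"
    and F_\<sigma>: "\<forall>\<^sub>F s in at_right 0. free_energy m chi s p \<sigma> \<le> - c"
    using exists_admissible_negative_free_energy[OF assms(1-4)] .
  have "\<forall>\<^sub>F s in at_right 0. s \<in> {0<..<real DIM('a) / p}"
    using assms(1) by (intro eventually_at_rightI[of 0 "DIM('a) / p"]) auto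
  with F_\<sigma> have "\<forall>\<^sub>F s in at_right 0. free_energy m chi s p (\<rho> s) \<le> - c"
    by eventually_elim (use min \<sigma> in force)
  with c show ?thesis
    using that by blast
qed

lemma ereal_le_Limsup_of_eventually:
  assumes "F \<noteq> bot" and "\<forall>\<^sub>F x in F. d \<le> f x"
  shows "ereal d \<le> Limsup F (\<lambda>x. ereal (f x))"
proof -
  have "ereal d \<le> Liminf F (\<lambda>x. ereal (f x))"
    using assms(2) by (intro Liminf_bounded) (simp add: eventually_mono)
  also have "\<dots> \<le> Limsup F (\<lambda>x. ereal (f x))"
    using assms(1) by (rule Liminf_le_Limsup)
  finally show ?thesis .
qed

theorem mainTheorem16:
  fixes \<rho> :: "real \<Rightarrow> 'a::euclidean_space \<Rightarrow> real" and p m chi M :: real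
  assumes "1 < p" and "conj_exp p < m" and "0 < chi" and "0 < M"
    and "\<forall>s\<in>{0<..<real DIM('a) / p}. \<rho> s \<in> admissible m M \<and>
           (\<forall>\<sigma>::'a \<Rightarrow> real\<in>admissible m M. free_energy m chi s p (\<rho> s) \<le> free_energy m chi s p \<sigma>)"
  shows "Limsup (at_right 0) (\<lambda>s. ereal (free_energy m chi s p (\<rho> s))) < 0
       \<and> Limsup (at_right 0) (\<lambda>s. ereal ((sobolev_exp (real DIM('a)) s p - conj_exp m) / M
              * (\<integral>x. \<rho> s x powr m \<partial>lebesgue))) > 0"
proof
  note p = assms(1) and M = assms(4) and min = assms(5)
  obtain c where c: "0 < c" and F: "\<forall>\<^sub>F s in at_right 0. free_energy m chi s p (\<rho> s) \<le> - c"
    using eventually_minimizer_free_energy_le[OF assms] .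
  have "Limsup (at_right 0) (\<lambda>s. ereal (free_energy m chi s p (\<rho> s))) \<le> - c"
    using F by (intro Limsup_bounded) (simp add: eventually_mono)
  then show "Limsup (at_right 0) (\<lambda>s. ereal (free_energy m chi s p (\<rho> s))) < 0"
    using c by (simp add: le_less_trans)
  define d where "d = (p - conj_exp m) / M * (c * (conj_exp p - 1) / 2)"
  have m: "1 < m" and m': "conj_exp m < p" and q: "1 < conj_exp p"
    using assms(2) conj_exp_gt_one[OF p] conj_exp_less_swap[OF p assms(2)] by simp_all
  have "\<forall>\<^sub>F s in at_right 0. p \<le> sobolev_exp DIM('a) s p"
    using p by (intro eventually_at_rightI[of 0 "DIM('a) / p"] le_sobolev_exp)
      (auto simp: pos_less_divide_eq)
  with eventually_minimizer_Lm_integral_ge[OF p m min F less_imp_le[OF c]]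
  have D: "\<forall>\<^sub>F s in at_right 0.
      d \<le> (sobolev_exp (real DIM('a)) s p - conj_exp m) / M * (\<integral>x. \<rho> s x powr m \<partial>lebesgue)"
  proof eventually_elim
    case (elim s)
    then show ?case
      unfolding d_def using m' M c q by (intro mult_mono divide_right_mono) simp_all
  qed
  have "0 < ereal d"
    using m' c M q by (simp add: d_def)
  also have "\<dots> \<le> Limsup (at_right 0) (\<lambda>s. ereal ((sobolev_exp (real DIM('a)) s p - conj_exp m) / M
      * (\<integral>x. \<rho> s x powr m \<partial>lebesgue)))"
    using trivial_limit_at_right_real D by (rule ereal_le_Limsup_of_eventually)
  finally show "Limsup (at_right 0) (\<lambda>s. ereal ((sobolev_exp (real DIM('a)) s p - conj_exp m) / M
      * (\<integral>x. \<rho> s x powr m \<partial>lebesgue))) > 0" .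
qed

end
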